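(* Let $(\Omega,\mathcal{F},\mathbb{P})$ be a probability space, let $k$ be a positive integer, and let $X_0,X_1,\dots,X_k$ be independent real random variables on $\Omega$. Then $$\mathbb{P}\Big(\bigcap_{i=1}^k\{X_i\ge X_0\}\Big)\ \ge\ \prod_{i=1}^k\mathbb{P}(X_i\ge X_0)$$ and $$\mathbb{P}\Big(\bigcap_{i=1}^k\{X_i\le X_0\}\Big)\ \ge\ \prod_{i=1}^k\mathbb{P}(X_i\le X_0).$$
   Context: Independence of $X_0,\dots,X_k$ means that for all Borel sets $A_0,\dots,A_k\subseteq\mathbb{R}$, $\mathbb{P}(\bigcap_{i=0}^k\{X_i\in A_i\})=\prod_{i=0}^k\mathbb{P}(X_i\in A_i)$. *)

theory Defs
  imports "HOL-Probability.Probability"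
begin

end

theory Submission
  imports Defs
begin

text \<open>
  Conditionally on X_0 = y the events X_i \<ge> y are independent, so the probability of their
  intersection is the mean of the product of the survival functions g_i(X_0). All g_i are
  antitone, and Chebyshev's association inequality says that the mean of such a product is at
  least the product of the means. The second inequality is the first one for -X.
\<close>

text \<open>Chebyshev's association inequality: the nonnegative quantity
  \<open>(f x - f y) * (g x - g y)\<close> is averaged first over \<open>y\<close> and then over
  \<open>x\<close>, which yields twice the difference of the two sides. Both averages are single
  integrals over \<open>M\<close>, so the argument stays clear of the product measure.\<close>

lemma (in prob_space) expectation_mult_ge_of_similarly_ordered:
  fixes f g :: "'a \<Rightarrow> real"
  assumes f: "integrable M f" and g: "integrable M g" and fg: "integrable M (\<lambda>x. f x * g x)"
    and ord: "\<And>x y. (f x - f y) * (g x - g y) \<ge> 0"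
  shows "expectation f * expectation g \<le> expectation (\<lambda>x. f x * g x)"
proof -
  define F where "F = expectation f"
  define G where "G = expectation g"
  define H where "H = expectation (\<lambda>x. f x * g x)"
  have *: "0 \<le> f x * g x - f x * G - g x * F + H" for x
  proof -
    have "0 \<le> (\<integral>y. (f x - f y) * (g x - g y) \<partial>M)"
      using ord by (intro integral_nonneg_AE) auto
    also have "\<dots> = (\<integral>y. f x * g x - f x * g y - g x * f y + f y * g y \<partial>M)"
      by (intro Bochner_Integration.integral_cong) (auto simp: algebra_simps)
    also have "\<dots> = f x * g x - f x * G - g x * F + H"
      using f g fg by (simp add: F_def G_def H_def prob_space)
    finally show ?thesis .
  qed
  have "0 \<le> (\<integral>x. f x * g x - f x * G - g x * F + H \<partial>M)"
    using * by (intro integral_nonneg_AE) auto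
  also have "\<dots> = 2 * H - 2 * F * G"
    using f g fg by (simp add: F_def G_def H_def prob_space)
  finally show ?thesis by (simp add: F_def G_def H_def)
qed

text \<open>Induction on the index set. A product of nonnegative antitone functions is again
  antitone, so the new factor and the product of the earlier ones are similarly ordered and
  Chebyshev's inequality applies. The bounds 0 and 1 make every product integrable.\<close>

lemma expectation_prod_antimono_ge:
  fixes g :: "'i \<Rightarrow> real \<Rightarrow> real"
  assumes D: "prob_space D" "sets D = sets borel" and "finite I"
    and anti: "\<And>i. i \<in> I \<Longrightarrow> antimono (g i)"
    and nonneg: "\<And>i x. i \<in> I \<Longrightarrow> 0 \<le> g i x" and le1: "\<And>i x. i \<in> I \<Longrightarrow> g i x \<le> 1"
  shows "(\<Prod>i\<in>I. \<integral>x. g i x \<partial>D) \<le> (\<integral>x. (\<Prod>i\<in>I. g i x) \<partial>D)"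
proof -
  interpret D: prob_space D by fact
  have integ: "integrable D f"
    if "antimono f" "\<And>x. 0 \<le> f x" "\<And>x. f x \<le> 1" for f :: "real \<Rightarrow> real"
  proof (rule D.integrable_const_bound[where B = 1])
    \<comment> \<open>Monotone real functions are Borel; negation turns the antitone
      \<open>f\<close> into a monotone one.\<close>
    have "(\<lambda>x. - f x) \<in> borel_measurable borel"
      using that(1) by (intro borel_measurable_mono) (auto simp: mono_def antimono_def)
    then have "f \<in> borel_measurable borel" by simp
    then show "f \<in> borel_measurable D"
      by (simp add: measurable_cong_sets[OF D(2) refl])
  qed (use that in auto)
  have anti_prod: "antimono (\<lambda>x. \<Prod>i\<in>J. g i x)" if "J \<subseteq> I" for J
    using that anti nonneg by (auto intro!: antimonoI prod_mono dest: antimonoD)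
  have prod01: "0 \<le> (\<Prod>i\<in>J. g i x)" "(\<Prod>i\<in>J. g i x) \<le> 1" if "J \<subseteq> I" for J x
    using that nonneg le1 by (auto intro!: prod_nonneg prod_le_1)
  \<comment> \<open>The induction runs over subsets \<open>J\<close> of \<open>I\<close>, so that
    the assumptions on the \<open>g i\<close> stay fixed.\<close>
  have "J \<subseteq> I \<Longrightarrow> (\<Prod>i\<in>J. \<integral>x. g i x \<partial>D) \<le> (\<integral>x. (\<Prod>i\<in>J. g i x) \<partial>D)"
    if "finite J" for J
    using that
  proof (induction J rule: finite_induct)
    case empty
    then show ?case by (simp add: D.prob_space)
  next
    case (insert j J)
    have j: "j \<in> I" and J: "J \<subseteq> I" using insert by auto
    have "(\<Prod>i\<in>insert j J. \<integral>x. g i x \<partial>D) = (\<integral>x. g j x \<partial>D) * (\<Prod>i\<in>J. \<integral>x. g i x \<partial>D)"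
      using insert by simp
    also have "\<dots> \<le> (\<integral>x. g j x \<partial>D) * (\<integral>x. (\<Prod>i\<in>J. g i x) \<partial>D)"
      using insert j nonneg by (intro mult_left_mono) auto
    also have "\<dots> \<le> (\<integral>x. g j x * (\<Prod>i\<in>J. g i x) \<partial>D)"
    proof (rule D.expectation_mult_ge_of_similarly_ordered)
      show "integrable D (g j)"
        using j anti nonneg le1 by (intro integ)
      show "integrable D (\<lambda>x. \<Prod>i\<in>J. g i x)"
        using J by (intro integ anti_prod prod01)
      have "integrable D (\<lambda>x. \<Prod>i\<in>insert j J. g i x)"
        using insert.prems by (intro integ anti_prod prod01)
      then show "integrable D (\<lambda>x. g j x * (\<Prod>i\<in>J. g i x))"
        using insert by simp
      \<comment> \<open>Both differences are nonnegative if \<open>x \<le> y\<close> and nonpositive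
        if \<open>y \<le> x\<close>.\<close>
      show "0 \<le> (g j x - g j y) * ((\<Prod>i\<in>J. g i x) - (\<Prod>i\<in>J. g i y))" for x y
      proof (cases "x \<le> y")
        case True
        then show ?thesis
          using antimonoD[OF anti[OF j] True] antimonoD[OF anti_prod[OF J] True]
          by (intro mult_nonneg_nonneg) auto
      next
        case False
        then have "y \<le> x" by simp
        then show ?thesis
          using antimonoD[OF anti[OF j] \<open>y \<le> x\<close>] antimonoD[OF anti_prod[OF J] \<open>y \<le> x\<close>]
          by (intro mult_nonpos_nonpos) auto
      qed
    qed
    finally show ?case using insert by simp
  qed
  then show ?thesis using \<open>finite I\<close> by blast
qed

text \<open>By independence the joint law is the product of the marginal laws. Tonelli's theorem
  with coordinate \<open>j\<close> outermost leaves, for each value \<open>y\<close> of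
  \<open>X j\<close>, the measure of a box with all sides \<open>{y..}\<close>.\<close>

lemma (in prob_space) prob_all_ge_eq_integral:
  fixes X :: "'i \<Rightarrow> 'a \<Rightarrow> real"
  assumes "finite I" and j: "j \<notin> I" and indep: "indep_vars (\<lambda>_. borel) X (insert j I)"
  shows "prob {\<omega> \<in> space M. \<forall>i\<in>I. X j \<omega> \<le> X i \<omega>} =
    (\<integral>y. (\<Prod>i\<in>I. measure (distr M borel (X i)) {y..}) \<partial>distr M borel (X j))"
proof -
  \<comment> \<open>The product locale asks for a probability measure at every index, while
    \<open>X i\<close> is known to be measurable only on \<open>insert j I\<close>; elsewhere a
    point mass serves as a dummy.\<close>
  define D where "D i = (if i \<in> insert j I then distr M borel (X i) else return borel 0)" for i
  have rv: "random_variable borel (X i)" if "i \<in> insert j I" for i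
    using indep that by (auto simp: indep_vars_def)
  have D: "prob_space (D i)" for i
    using rv by (auto simp: D_def intro!: prob_space_distr prob_space_return)
  interpret D: product_prob_space D
    by (intro product_prob_space.intro product_sigma_finite.intro product_prob_space_axioms.intro
        D prob_space_imp_sigma_finite)
  have setsD [simp, measurable_cong]: "sets (D i) = sets borel" for i by (simp add: D_def)
  have spaceD [simp]: "space (D i) = UNIV" for i
    using sets_eq_imp_space_eq[OF setsD] by simp
  define P where "P = PiM (insert j I) (\<lambda>i. borel :: real measure)"
  define S where "S = {x \<in> space P. \<forall>i\<in>I. x j \<le> x i}"
  have S: "S \<in> sets P"
    unfolding S_def P_def using \<open>finite I\<close>
    by (intro sets.sets_Collect_finite_All borel_measurable_le measurable_component_singleton) auto
  have setsP: "sets (PiM (insert j I) D) = sets P"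
    unfolding P_def by (intro sets_PiM_cong) auto
  \<comment> \<open>Independence enters here, as the factorization of the joint law.\<close>
  have distr: "distr M P (\<lambda>\<omega>. \<lambda>i\<in>insert j I. X i \<omega>) = PiM (insert j I) D"
    using indep_vars_iff_distr_eq_PiM'[of "insert j I" X "\<lambda>_. borel"] rv indep
    by (auto simp: P_def D_def intro!: PiM_cong)
  have meas: "(\<lambda>\<omega>. \<lambda>i\<in>insert j I. X i \<omega>) \<in> measurable M P"
    unfolding P_def using rv by (intro measurable_restrict)
  have "emeasure M {\<omega> \<in> space M. \<forall>i\<in>I. X j \<omega> \<le> X i \<omega>} =
      emeasure M ((\<lambda>\<omega>. \<lambda>i\<in>insert j I. X i \<omega>) -` S \<inter> space M)"
    by (rule arg_cong[where f = "emeasure M"]) (auto simp: S_def P_def space_PiM)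
  also have "\<dots> = emeasure (PiM (insert j I) D) S"
    using meas S by (simp add: emeasure_distr flip: distr)
  also have "\<dots> = (\<integral>\<^sup>+ x. indicator S x \<partial>PiM (insert j I) D)"
    using S by (simp add: setsP)
  also have "\<dots> = (\<integral>\<^sup>+ y. \<integral>\<^sup>+ x. indicator S (x(j := y)) \<partial>PiM I D \<partial>D j)"
    using S \<open>finite I\<close> j
    by (intro D.product_nn_integral_insert_rev) (simp_all add: measurable_cong_sets[OF setsP refl])
  \<comment> \<open>Since \<open>j\<close> lies outside \<open>I\<close>, the update at
    \<open>j\<close> changes only the threshold, so the section of \<open>S\<close> at
    \<open>y\<close> is a box.\<close>
  also have "\<dots> = (\<integral>\<^sup>+ y. \<integral>\<^sup>+ x. indicator (PiE I (\<lambda>i. {y..})) x \<partial>PiM I D \<partial>D j)"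
    using j by (intro nn_integral_cong)
      (auto simp: S_def P_def space_PiM indicator_def PiE_def Pi_def extensional_def)
  also have "\<dots> = (\<integral>\<^sup>+ y. (\<Prod>i\<in>I. emeasure (D i) {y..}) \<partial>D j)"
    using \<open>finite I\<close> by (intro nn_integral_cong)
      (subst nn_integral_indicator, auto intro!: sets_PiM_I_finite D.emeasure_PiM)
  also have "\<dots> = (\<integral>\<^sup>+ y. ennreal (\<Prod>i\<in>I. measure (D i) {y..}) \<partial>D j)"
    by (simp add: D.M.emeasure_eq_measure prod_ennreal)
  finally have "prob {\<omega> \<in> space M. \<forall>i\<in>I. X j \<omega> \<le> X i \<omega>} =
      enn2real (\<integral>\<^sup>+ y. ennreal (\<Prod>i\<in>I. measure (D i) {y..}) \<partial>D j)"
    by (simp add: measure_def)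
  also have "\<dots> = (\<integral>y. (\<Prod>i\<in>I. measure (D i) {y..}) \<partial>D j)"
  proof (rule integral_eq_nn_integral[symmetric])
    \<comment> \<open>The rays \<open>{y..}\<close> shrink as \<open>y\<close> grows, so the negated
      survival function is monotone and hence Borel.\<close>
    have "(\<lambda>y. - measure (D i) {y..}) \<in> borel_measurable borel" for i
      by (intro borel_measurable_mono monoI) (auto intro!: D.M.finite_measure_mono)
    then have "(\<lambda>y. measure (D i) {y..}) \<in> borel_measurable (D j)" for i
      by (simp add: measurable_cong_sets[OF setsD refl])
    then show "(\<lambda>y. \<Prod>i\<in>I. measure (D i) {y..}) \<in> borel_measurable (D j)"
      by (intro borel_measurable_prod)
  qed (auto intro!: prod_nonneg)
  finally show ?thesis by (simp add: D_def cong: prod.cong)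
qed

text \<open>Both sides are rewritten as integrals of survival functions against the law of
  \<open>X j\<close>; the inequality for antitone functions then compares them.\<close>

lemma (in prob_space) prob_all_ge_prod:
  fixes X :: "'i \<Rightarrow> 'a \<Rightarrow> real"
  assumes "finite I" and j: "j \<notin> I" and indep: "indep_vars (\<lambda>_. borel) X (insert j I)"
  shows "(\<Prod>i\<in>I. prob {\<omega> \<in> space M. X j \<omega> \<le> X i \<omega>})
    \<le> prob {\<omega> \<in> space M. \<forall>i\<in>I. X j \<omega> \<le> X i \<omega>}"
proof -
  have rv: "random_variable borel (X i)" if "i \<in> insert j I" for i
    using indep that by (auto simp: indep_vars_def)
  define g where "g i y = measure (distr M borel (X i)) {y..}" for i y
  have ps: "prob_space (distr M borel (X i))" if "i \<in> insert j I" for i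
    using rv[OF that] by (rule prob_space_distr)
  have "(\<Prod>i\<in>I. prob {\<omega> \<in> space M. X j \<omega> \<le> X i \<omega>}) =
      (\<Prod>i\<in>I. \<integral>y. g i y \<partial>distr M borel (X j))"
  proof (rule prod.cong[OF refl])
    fix i assume "i \<in> I"
    \<comment> \<open>Each single factor is the integral formula for the index set
      \<open>{i}\<close>, which requires independence of the pair \<open>X j\<close>,
      \<open>X i\<close> only.\<close>
    moreover from this have "indep_vars (\<lambda>_. borel) X (insert j {i})"
      by (intro indep_vars_subset[OF indep]) auto
    ultimately show "prob {\<omega> \<in> space M. X j \<omega> \<le> X i \<omega>} =
        (\<integral>y. g i y \<partial>distr M borel (X j))"
      using prob_all_ge_eq_integral[of "{i}" j X] j by (auto simp: g_def)
  qed
  also have "\<dots> \<le> (\<integral>y. (\<Prod>i\<in>I. g i y) \<partial>distr M borel (X j))"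
  proof (rule expectation_prod_antimono_ge)
    fix i assume i: "i \<in> I"
    interpret Di: prob_space "distr M borel (X i)" using ps i by simp
    show "antimono (g i)"
      by (intro antimonoI) (auto simp: g_def intro!: Di.finite_measure_mono)
    show "0 \<le> g i y" "g i y \<le> 1" for y by (simp_all add: g_def)
  qed (use ps \<open>finite I\<close> in auto)
  also have "\<dots> = prob {\<omega> \<in> space M. \<forall>i\<in>I. X j \<omega> \<le> X i \<omega>}"
    using prob_all_ge_eq_integral[OF assms] by (simp add: g_def)
  finally show ?thesis .
qed

theorem mainTheorem3:
  fixes M :: "'a measure" and X :: "nat \<Rightarrow> 'a \<Rightarrow> real" and k :: nat
  assumes "prob_space M"
    and "k \<ge> 1"
    and "prob_space.indep_vars M (\<lambda>_. borel) X {0..k}"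
  shows "measure M (\<Inter>i\<in>{1..k}. {\<omega> \<in> space M. X i \<omega> \<ge> X 0 \<omega>})
           \<ge> (\<Prod>i\<in>{1..k}. measure M {\<omega> \<in> space M. X i \<omega> \<ge> X 0 \<omega>})
       \<and> measure M (\<Inter>i\<in>{1..k}. {\<omega> \<in> space M. X i \<omega> \<le> X 0 \<omega>})
           \<ge> (\<Prod>i\<in>{1..k}. measure M {\<omega> \<in> space M. X i \<omega> \<le> X 0 \<omega>})"
proof -
  interpret prob_space M by fact
  have I: "{0..k} = insert 0 {1..k}" by auto
  \<comment> \<open>Here \<open>k \<ge> 1\<close> matters: an intersection over an empty index set
    would be \<open>UNIV\<close> instead of \<open>space M\<close>.\<close>
  have Int: "(\<Inter>i\<in>{1..k}. {\<omega> \<in> space M. Q i \<omega>}) = {\<omega> \<in> space M. \<forall>i\<in>{1..k}. Q i \<omega>}" for Q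
    using \<open>k \<ge> 1\<close> by auto
  have indep: "indep_vars (\<lambda>_. borel) X (insert 0 {1..k})"
    using assms(3) by (simp only: I)
  \<comment> \<open>Negation is Borel, so it preserves independence, and it reverses each comparison
    with \<open>X 0\<close>.\<close>
  have indep': "indep_vars (\<lambda>_. borel) (\<lambda>i \<omega>. - X i \<omega>) (insert 0 {1..k})"
    by (rule indep_vars_compose2[OF indep, where Y = "\<lambda>_ x. - x"]) simp
  show ?thesis
    unfolding Int
    using prob_all_ge_prod[OF _ _ indep] prob_all_ge_prod[OF _ _ indep'] by simp
qed

end
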